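(* For every nonempty finite word $w\in\{L,R\}^\star$, $$\min(\operatorname{supp}(P_w))=-(|w|_L+1),\qquad \max(\operatorname{supp}(P_w))=|w|_R+1,$$ and $$P_w\bigl(-(|w|_L+1)\bigr)=\left(\tfrac12\right)^{|w|_L+1},\qquad P_w\bigl(|w|_R+1\bigr)=\left(\tfrac12\right)^{|w|_R+1}.$$
   Context: $\{L,R\}^\star$ is the set of all finite words in the letters $L,R$, including the empty word $\varepsilon$. $|w|_L$ and $|w|_R$ are the numbers of occurrences of the letters $L$ and $R$ in $w$. For a probability measure $P$ on $\mathbb{Z}$, $\operatorname{supp}(P)=\{d\in\mathbb{Z}:P(d)>0\}$. For probability measures $\mu,\nu$ on $\mathbb{Z}$ with mean zero, $\Phi(\mu,\nu)(d)=\frac12\mu(d+1)+\frac12\nu(d-1)$, $\Phi_L(\mu,\nu)=(\Phi(\mu,\nu),\nu)$, $\Phi_R(\mu,\nu)=(\mu,\Phi(\mu,\nu))$. For a word $w=w_1\dots w_n$ put $P_w=\Phi\circ\Phi_{w_n}\circ\cdots\circ\Phi_{w_1}(\delta_0,\delta_0)$, with $P_\varepsilon=\Phi(\delta_0,\delta_0)=\frac12\delta_{-1}+\frac12\delta_1$. *)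

theory Defs
  imports "HOL-Probability.Probability"
begin

lift_definition Phi :: "int pmf \<Rightarrow> int pmf \<Rightarrow> int pmf" is
  "\<lambda>\<mu> \<nu> d. 1/2 * \<mu> (d + 1) + 1/2 * \<nu> (d - 1)"
proof -
  fix f g :: "int \<Rightarrow> real"
  assume f: "(\<forall>x. 0 \<le> f x) \<and> (\<integral>\<^sup>+x. ennreal (f x) \<partial>count_space UNIV) = 1"
    and g: "(\<forall>x. 0 \<le> g x) \<and> (\<integral>\<^sup>+x. ennreal (g x) \<partial>count_space UNIV) = 1"
  have f1: "(\<integral>\<^sup>+d. ennreal (f (d + 1)) \<partial>count_space UNIV) = 1"
    using nn_integral_bij_count_space[of "\<lambda>d::int. d + 1" UNIV UNIV "\<lambda>x. ennreal (f x)"] f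
    by (simp add: bij_plus_right)
  have "bij (\<lambda>d::int. d - 1)"
    by (rule bij_betw_byWitness[where f' = "\<lambda>d. d + 1"]) auto
  then have g1: "(\<integral>\<^sup>+d. ennreal (g (d - 1)) \<partial>count_space UNIV) = 1"
    using nn_integral_bij_count_space[of "\<lambda>d::int. d - 1" UNIV UNIV "\<lambda>x. ennreal (g x)"] g
    by simp
  have "(\<integral>\<^sup>+d. ennreal (1/2 * f (d + 1) + 1/2 * g (d - 1)) \<partial>count_space UNIV) =
      (\<integral>\<^sup>+d. ennreal (1/2) * ennreal (f (d + 1)) + ennreal (1/2) * ennreal (g (d - 1)) \<partial>count_space UNIV)"
    using f g by (intro nn_integral_cong) (subst ennreal_plus, simp_all only: ennreal_mult' zero_le_divide_1_iff zero_le_numeral mult_nonneg_nonneg)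
  also have "\<dots> = ennreal (1/2) + ennreal (1/2)"
    by (subst nn_integral_add) (simp_all add: nn_integral_cmult f1 g1)
  also have "\<dots> = 1"
    by (subst ennreal_plus[symmetric]) simp_all
  finally show "(\<forall>d. 0 \<le> 1/2 * f (d + 1) + 1/2 * g (d - 1)) \<and>
      (\<integral>\<^sup>+d. ennreal (1/2 * f (d + 1) + 1/2 * g (d - 1)) \<partial>count_space UNIV) = 1"
    using f g by simp
qed

lemmas pmf_Phi = Phi.rep_eq

(* Phi is total on int pmf; mean_zero_Phi and mean_zero_return_pmf show that the measures
   occurring in word_pmf lie in the intended domain, the measures with mean zero. *)
definition mean_zero :: "int pmf \<Rightarrow> bool" where
  "mean_zero \<mu> \<longleftrightarrow>
     integrable (measure_pmf \<mu>) real_of_int \<and> measure_pmf.expectation \<mu> real_of_int = 0"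

lemma set_pmf_Phi:
  "set_pmf (Phi \<mu> \<nu>) = (\<lambda>x. x - 1) ` set_pmf \<mu> \<union> (\<lambda>x. x + 1) ` set_pmf \<nu>"
proof (rule set_eqI)
  fix d
  have "d \<in> set_pmf (Phi \<mu> \<nu>) \<longleftrightarrow> d + 1 \<in> set_pmf \<mu> \<or> d - 1 \<in> set_pmf \<nu>"
    using pmf_nonneg[of \<mu> "d + 1"] pmf_nonneg[of \<nu> "d - 1"]
    by (auto simp: set_pmf_iff pmf_Phi simp del: pmf_nonneg)
  moreover have "d + 1 \<in> A \<longleftrightarrow> d \<in> (\<lambda>x. x - 1) ` A" "d - 1 \<in> A \<longleftrightarrow> d \<in> (\<lambda>x. x + 1) ` A" for A
    by force+
  ultimately show "d \<in> set_pmf (Phi \<mu> \<nu>) \<longleftrightarrow>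
      d \<in> (\<lambda>x. x - 1) ` set_pmf \<mu> \<union> (\<lambda>x. x + 1) ` set_pmf \<nu>"
    by blast
qed

lemma mean_zero_return_pmf: "mean_zero (return_pmf 0)"
  by (simp add: mean_zero_def integrable_measure_pmf_finite)

lemma has_bochner_integral_pmf_iff:
  fixes f :: "'a \<Rightarrow> real"
  shows "has_bochner_integral (measure_pmf p) f x \<longleftrightarrow>
         has_bochner_integral (count_space UNIV) (\<lambda>d. pmf p d * f d) x"
  by (simp add: measure_pmf_eq_density has_bochner_integral_iff integrable_density integral_density)

lemma has_bochner_integral_shift:
  fixes f :: "int \<Rightarrow> real"
  assumes "has_bochner_integral (count_space UNIV) f x"
  shows "has_bochner_integral (count_space UNIV) (\<lambda>d. f (d + c)) x"
  using assms integrable_bij_count_space[of "\<lambda>d. d + c" UNIV UNIV f]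
    integral_bij_count_space[of "\<lambda>d. d + c" UNIV UNIV f]
  by (simp add: has_bochner_integral_iff bij_plus_right)

lemma mean_zero_Phi:
  assumes "mean_zero \<mu>" "mean_zero \<nu>"
  shows "mean_zero (Phi \<mu> \<nu>)"
proof -
  have shifted: "has_bochner_integral (count_space UNIV) (\<lambda>d. pmf p (d + c) * real_of_int d) (real_of_int (- c))"
    if "mean_zero p" for p and c :: int
  proof -
    have "has_bochner_integral (measure_pmf p) real_of_int 0"
      using that by (simp add: mean_zero_def has_bochner_integral_iff)
    moreover have "has_bochner_integral (measure_pmf p) (\<lambda>_. real_of_int c) c"
      by (simp add: has_bochner_integral_iff)
    ultimately have "has_bochner_integral (measure_pmf p) (\<lambda>d. real_of_int d - c) (0 - real_of_int c)"
      by (rule has_bochner_integral_diff)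
    then have "has_bochner_integral (count_space UNIV) (\<lambda>d. pmf p d * (real_of_int d - c)) (0 - real_of_int c)"
      by (simp only: has_bochner_integral_pmf_iff)
    from has_bochner_integral_shift[OF this, of c] show ?thesis
      by simp
  qed
  have "has_bochner_integral (count_space UNIV)
      (\<lambda>d. 1/2 * (pmf \<mu> (d + 1) * real_of_int d) + 1/2 * (pmf \<nu> (d + (-1)) * real_of_int d))
      (1/2 * real_of_int (- 1) + 1/2 * real_of_int (- (-1)))"
    by (intro has_bochner_integral_add has_bochner_integral_mult_right shifted assms)
  then have "has_bochner_integral (measure_pmf (Phi \<mu> \<nu>)) real_of_int 0"
    by (simp add: has_bochner_integral_pmf_iff pmf_Phi algebra_simps)
  then show ?thesis
    by (simp add: mean_zero_def has_bochner_integral_iff)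
qed

datatype letter = L | R

fun Phi_step :: "letter \<Rightarrow> int pmf \<times> int pmf \<Rightarrow> int pmf \<times> int pmf" where
  "Phi_step L (\<mu>, \<nu>) = (Phi \<mu> \<nu>, \<nu>)"
| "Phi_step R (\<mu>, \<nu>) = (\<mu>, Phi \<mu> \<nu>)"

(* fold applies the step of the first letter of w first. *)
definition word_pmf :: "letter list \<Rightarrow> int pmf" where
  "word_pmf w = case_prod Phi (fold Phi_step w (return_pmf 0, return_pmf 0))"

lemma word_pmf_Nil: "word_pmf [] = Phi (return_pmf 0) (return_pmf 0)"
  by (simp add: word_pmf_def)

(* Min and Max are only meaningful on finite nonempty sets; see also set_pmf_not_empty. *)
lemma finite_set_pmf_word_pmf: "finite (set_pmf (word_pmf w))"
proof -
  have "finite (set_pmf (fst (fold Phi_step w p))) \<and> finite (set_pmf (snd (fold Phi_step w p)))"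
    if "finite (set_pmf (fst p))" "finite (set_pmf (snd p))" for p
    using that
  proof (induction w arbitrary: p)
    case (Cons a w)
    show ?case
      using Cons.prems
      by (cases a; cases p) (auto intro!: Cons.IH simp: set_pmf_Phi)
  qed simp
  from this[of "(return_pmf 0, return_pmf 0)"] show ?thesis
    by (auto simp: word_pmf_def set_pmf_Phi split: prod.splits)
qed

end

theory Submission
  imports Defs
begin

text \<open>
  After reading \<open>w\<close>, the left measure has minimum \<open>- l\<close> and the right one maximum \<open>r\<close>, where \<open>l\<close> and
  \<open>r\<close> count the letters \<open>L\<close> and \<open>R\<close>. The opposite ends lag by at most one: the right measure vanishes
  below \<open>- l - 1\<close> and the left one above \<open>r + 1\<close>. Hence \<open>Phi\<close> moves each extreme atom outwards by one,
  where the other measure contributes no mass, and thereby halves it.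
\<close>

lemma fold_Phi_step_extremes:
  assumes "fold Phi_step w (return_pmf 0, return_pmf 0) = (\<mu>, \<nu>)"
  shows "pmf \<mu> (- int (count_list w L)) = (1/2) ^ count_list w L"
    and "pmf \<nu> (int (count_list w R)) = (1/2) ^ count_list w R"
    and "d < - int (count_list w L) \<Longrightarrow> pmf \<mu> d = 0"
    and "d < - int (count_list w L) - 1 \<Longrightarrow> pmf \<nu> d = 0"
    and "d > int (count_list w R) \<Longrightarrow> pmf \<nu> d = 0"
    and "d > int (count_list w R) + 1 \<Longrightarrow> pmf \<mu> d = 0"
  using assms
\<comment> \<open>An appended letter acts last, on the pair the hypothesis describes;
  \<open>d\<close> varies because \<open>Phi\<close> reads both neighbours of
  \<open>d\<close>.\<close>
proof (induction w arbitrary: \<mu> \<nu> d rule: rev_induct)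
  case Nil
  { case 1 then show ?case by auto
  next case 2 then show ?case by auto
  next case 3 then show ?case by auto
  next case 4 then show ?case by auto
  next case 5 then show ?case by auto
  next case 6 then show ?case by auto }
next
  case (snoc a w)
  obtain \<mu>' \<nu>' where w: "fold Phi_step w (return_pmf 0, return_pmf 0) = (\<mu>', \<nu>')"
    by (metis surj_pair)
  note IH = snoc.IH(1,2)[OF w] snoc.IH(3-6)[OF _ w]
  \<comment> \<open>A letter \<open>R\<close> copies the left atom at \<open>- l\<close> into the
    right measure at \<open>- l - 1\<close>, so the lag of one cannot be tightened; mirrored for
    \<open>L\<close>.\<close>
  { case 1 then show ?case using w IH by (cases a) (auto simp: pmf_Phi)
  next case 2 then show ?case using w IH by (cases a) (auto simp: pmf_Phi)
  next case 3 then show ?case using w IH by (cases a) (auto simp: pmf_Phi)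
  next case 4 then show ?case using w IH by (cases a) (auto simp: pmf_Phi)
  next case 5 then show ?case using w IH by (cases a) (auto simp: pmf_Phi)
  next case 6 then show ?case using w IH by (cases a) (auto simp: pmf_Phi) }
qed

theorem mainTheorem8:
  fixes w :: "letter list"
  assumes "w \<noteq> []"
  shows "Min (set_pmf (word_pmf w)) = - (int (count_list w L) + 1)
       \<and> Max (set_pmf (word_pmf w)) = int (count_list w R) + 1
       \<and> pmf (word_pmf w) (- (int (count_list w L) + 1)) = (1/2) ^ (count_list w L + 1)
       \<and> pmf (word_pmf w) (int (count_list w R) + 1) = (1/2) ^ (count_list w R + 1)"
proof -
  let ?l = "int (count_list w L)" and ?r = "int (count_list w R)"
  obtain \<mu> \<nu> where w: "fold Phi_step w (return_pmf 0, return_pmf 0) = (\<mu>, \<nu>)"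
    by (metis surj_pair)
  note extremes = fold_Phi_step_extremes[OF w]
  have P: "pmf (word_pmf w) d = 1/2 * pmf \<mu> (d + 1) + 1/2 * pmf \<nu> (d - 1)" for d
    by (simp add: word_pmf_def w pmf_Phi)
  \<comment> \<open>Here \<open>\<nu>\<close> is read at \<open>- ?l - 2\<close> and
    \<open>\<mu>\<close> at \<open>?r + 2\<close>, each just past its lag bound.\<close>
  have lower: "pmf (word_pmf w) (- (?l + 1)) = (1/2) ^ (count_list w L + 1)"
    and upper: "pmf (word_pmf w) (?r + 1) = (1/2) ^ (count_list w R + 1)"
    by (simp_all add: P extremes)
  have "pmf (word_pmf w) d = 0" if "d < - (?l + 1) \<or> d > ?r + 1" for d
    using that by (auto simp: P extremes)
  then have bounds: "- (?l + 1) \<le> d \<and> d \<le> ?r + 1" if "d \<in> set_pmf (word_pmf w)" for d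
    using that by (meson not_le set_pmf_iff)
  have "Min (set_pmf (word_pmf w)) = - (?l + 1)"
    using lower bounds by (intro Min_eqI finite_set_pmf_word_pmf) (auto simp: set_pmf_iff)
  moreover have "Max (set_pmf (word_pmf w)) = ?r + 1"
    using upper bounds by (intro Max_eqI finite_set_pmf_word_pmf) (auto simp: set_pmf_iff)
  ultimately show ?thesis
    using lower upper by simp
qed

end
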